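(* Let $X$ be a Tychonoff $\Delta$-space, let $Y$ be a Tychonoff $\sigma$-closed discrete space (in particular, $Y$ may be any countable Tychonoff space), and let $Z = X\times Y$. Then $Z$ is also a $\Delta$-space.
   Context: A topological space $X$ is a $\Delta$-space if for every decreasing sequence $\{D_n: n \in \omega\}$ of subsets of $X$ with empty intersection there is a decreasing sequence $\{V_n: n \in \omega\}$ of open subsets of $X$, also with empty intersection, such that $D_n \subset V_n$ for every $n \in \omega$. A space $Y$ is $\sigma$-closed discrete if $Y = \bigcup_{n\in\omega}Y_n$, where each $Y_n$ is a closed and discrete subset of $Y$. *)

theory Defs
  imports "HOL-Analysis.Analysis"
begin

(* completely_regular_space includes no separation axiom. *)
definition tychonoff_space :: "'a topology \<Rightarrow> bool" where
  "tychonoff_space X \<longleftrightarrow> completely_regular_space X \<and> Hausdorff_space X"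

(* "Decreasing" is read in the non-strict sense. *)
definition Delta_space :: "'a topology \<Rightarrow> bool" where
  "Delta_space X \<longleftrightarrow>
     (\<forall>D :: nat \<Rightarrow> 'a set.
        (\<forall>n. D n \<subseteq> topspace X) \<and> decseq D \<and> (\<Inter>n. D n) = {} \<longrightarrow>
        (\<exists>V :: nat \<Rightarrow> 'a set.
           (\<forall>n. openin X (V n)) \<and> decseq V \<and> (\<Inter>n. V n) = {} \<and> (\<forall>n. D n \<subseteq> V n)))"

definition sigma_closed_discrete_space :: "'a topology \<Rightarrow> bool" where
  "sigma_closed_discrete_space Y \<longleftrightarrow>
     (\<exists>C :: nat \<Rightarrow> 'a set.
        (\<forall>n. closedin Y (C n) \<and> subtopology Y (C n) = discrete_topology (C n)) \<and>
        topspace Y = (\<Union>n. C n))"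

end

theory Submission
  imports Defs
begin

text \<open>
  Two stability properties of \<open>\<Delta>\<close>-spaces give the result. First, multiplying a \<open>\<Delta>\<close>-space by a
  discrete space produces a topological sum of copies of it, and the open expansions can be chosen
  separately in each copy (\<open>Delta_space_prod_discrete\<close>). Second, being a \<open>\<Delta>\<close>-space passes from
  countably many closed pieces to their union (\<open>Delta_space_closed_countable_cover\<close>): an open
  expansion inside a closed piece stays open after the complement of the piece is added, and it is
  harmless to impose the constraint of the \<open>n\<close>-th piece only from stage \<open>n\<close> on, so that every stage
  is a finite intersection of open sets. If \<open>Y\<close> is the union of closed discrete sets \<open>C n\<close>, then the
  sets \<open>X \<times> C n\<close> are such pieces of \<open>X \<times> Y\<close>. A countable space with closed points
  is the union of its singletons.
\<close>

lemma Delta_spaceE: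
  assumes "Delta_space X" "\<And>n. D n \<subseteq> topspace X" "decseq D" "(\<Inter>n. D n) = {}"
  obtains V where "\<And>n. openin X (V n)" "decseq V" "(\<Inter>n. V n) = {}" "\<And>n. D n \<subseteq> V n"
  using assms unfolding Delta_space_def by metis

lemma Delta_space_prod_discrete:
  assumes "Delta_space X"
  shows "Delta_space (prod_topology X (discrete_topology S))"
  unfolding Delta_space_def
proof (intro allI impI, elim conjE)
  fix D :: "nat \<Rightarrow> ('a \<times> 'b) set"
  assume D: "\<forall>n. D n \<subseteq> topspace (prod_topology X (discrete_topology S))"
    and dec: "decseq D" and emp: "(\<Inter>n. D n) = {}"
  have "\<exists>V. (\<forall>n. openin X (V n)) \<and> decseq V \<and> (\<Inter>n. V n) = {} \<and> (\<forall>n. {x. (x, y) \<in> D n} \<subseteq> V n)" for y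
  proof -
    have "{x. (x, y) \<in> D n} \<subseteq> topspace X" for n
      using D by fastforce
    moreover have "decseq (\<lambda>n. {x. (x, y) \<in> D n})"
      using dec unfolding decseq_def by blast
    moreover have "(\<Inter>n. {x. (x, y) \<in> D n}) = {}"
      using emp by blast
    ultimately show ?thesis
      by (rule Delta_spaceE[OF assms]) blast
  qed
  then obtain V where V: "\<And>y n. openin X (V y n)" "\<And>y. decseq (V y)" "\<And>y. (\<Inter>n. V y n) = {}"
      "\<And>y n. {x. (x, y) \<in> D n} \<subseteq> V y n"
    by metis
  define W where "W n = (\<Union>y\<in>S. V y n \<times> {y})" for n
  have "openin (prod_topology X (discrete_topology S)) (W n)" for n
    unfolding W_def by (intro openin_Union) (auto simp: openin_prod_Times_iff V(1))
  moreover have "decseq W"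
    using V(2) unfolding W_def decseq_def by blast
  moreover have "(\<Inter>n. W n) = {}"
  proof (rule equals0I)
    fix p
    assume "p \<in> (\<Inter>n. W n)"
    then have "fst p \<in> V (snd p) n" for n
      unfolding W_def by auto
    then show False
      using V(3)[of "snd p"] by blast
  qed
  moreover have "D n \<subseteq> W n" for n
  proof
    fix p
    assume "p \<in> D n"
    obtain x y where p: "p = (x, y)"
      by fastforce
    have "p \<in> topspace X \<times> S"
      using D \<open>p \<in> D n\<close> by auto
    moreover have "x \<in> V y n"
      using V(4)[where y = y and n = n] \<open>p \<in> D n\<close> p by blast
    ultimately show "p \<in> W n"
      using p unfolding W_def by blast
  qed
  ultimately show "\<exists>W. (\<forall>n. openin (prod_topology X (discrete_topology S)) (W n)) \<and> decseq W \<and>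
      (\<Inter>n. W n) = {} \<and> (\<forall>n. D n \<subseteq> W n)"
    by blast
qed

lemma openin_Un_complement_closedin:
  assumes "closedin Z F" "openin (subtopology Z F) V"
  shows "openin Z (V \<union> (topspace Z - F))"
proof -
  obtain U where "openin Z U" "V = U \<inter> F"
    using assms(2) by (auto simp: openin_subtopology)
  then have "V \<union> (topspace Z - F) = U \<union> (topspace Z - F)"
    using openin_subset by blast
  then show ?thesis
    using \<open>openin Z U\<close> assms(1) by auto
qed

text \<open>
  The sets of stage \<open>k\<close> satisfy the constraints of the pieces \<open>F 0, \<dots>, F k\<close> only. This keeps
  them open, and a point of \<open>F n\<close> is still excluded, because it meets the constraint of \<open>F n\<close> at all
  stages \<open>k \<ge> n\<close> and the expansion in \<open>F n\<close> decreases to the empty set.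
\<close>
lemma Delta_space_closed_countable_cover:
  fixes F :: "nat \<Rightarrow> 'a set"
  assumes closed: "\<And>n. closedin Z (F n)" and cover: "topspace Z = (\<Union>n. F n)"
    and Delta: "\<And>n. Delta_space (subtopology Z (F n))"
  shows "Delta_space Z"
  unfolding Delta_space_def
proof (intro allI impI, elim conjE)
  fix D :: "nat \<Rightarrow> 'a set"
  assume D: "\<forall>k. D k \<subseteq> topspace Z" and dec: "decseq D" and emp: "(\<Inter>k. D k) = {}"
  have "\<exists>V. (\<forall>k. openin (subtopology Z (F n)) (V k)) \<and> decseq V \<and> (\<Inter>k. V k) = {} \<and>
      (\<forall>k. D k \<inter> F n \<subseteq> V k)" for n
  proof -
    have "D k \<inter> F n \<subseteq> topspace (subtopology Z (F n))" for k
      using D by auto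
    moreover have "decseq (\<lambda>k. D k \<inter> F n)"
      using dec unfolding decseq_def by blast
    moreover have "(\<Inter>k. D k \<inter> F n) = {}"
      using emp by blast
    ultimately show ?thesis
      by (rule Delta_spaceE[OF Delta]) blast
  qed
  then obtain V where V: "\<And>n k. openin (subtopology Z (F n)) (V n k)" "\<And>n. decseq (V n)"
      "\<And>n. (\<Inter>k. V n k) = {}" "\<And>n k. D k \<inter> F n \<subseteq> V n k"
    by metis
  define W where "W k = (\<Inter>n\<le>k. V n k \<union> (topspace Z - F n))" for k
  have "openin Z (W k)" for k
    unfolding W_def by (intro openin_INT2) (auto intro: openin_Un_complement_closedin closed V(1))
  moreover have "decseq W"
    unfolding decseq_def
  proof (intro allI impI subsetI)
    fix j k x
    assume "j \<le> k" "x \<in> W k"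
    then have "x \<in> V n j \<union> (topspace Z - F n)" if "n \<le> j" for n
      using V(2)[of n] that unfolding W_def decseq_def by fastforce
    then show "x \<in> W j"
      unfolding W_def by blast
  qed
  moreover have "(\<Inter>k. W k) = {}"
  proof (rule ccontr)
    assume "(\<Inter>k. W k) \<noteq> {}"
    then obtain x where x: "\<And>k. x \<in> W k"
      by blast
    then have "x \<in> topspace Z"
      using \<open>\<And>k. openin Z (W k)\<close> openin_subset by blast
    then obtain n where n: "x \<in> F n"
      using cover by blast
    have "x \<in> V n k" for k
    proof -
      have "x \<in> V n (max n k)"
        using x[of "max n k"] n unfolding W_def by auto
      then show ?thesis
        using V(2)[of n] unfolding decseq_def by (meson max.cobounded2 subsetD)
    qed
    then show False
      using V(3)[of n] by blast
  qed
  moreover have "D k \<subseteq> W k" for k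
    using D V(4) unfolding W_def by blast
  ultimately show "\<exists>W. (\<forall>k. openin Z (W k)) \<and> decseq W \<and> (\<Inter>k. W k) = {} \<and> (\<forall>k. D k \<subseteq> W k)"
    by blast
qed

lemma Delta_space_prod_sigma_closed_discrete:
  assumes "Delta_space X" "sigma_closed_discrete_space Y"
  shows "Delta_space (prod_topology X Y)"
proof -
  obtain C where C: "\<And>n::nat. closedin Y (C n)" "\<And>n. subtopology Y (C n) = discrete_topology (C n)"
      "topspace Y = (\<Union>n. C n)"
    using assms(2) unfolding sigma_closed_discrete_space_def by blast
  show ?thesis
  proof (rule Delta_space_closed_countable_cover)
    show "closedin (prod_topology X Y) (topspace X \<times> C n)" for n
      using C(1) by (simp add: closedin_prod_Times_iff)
    show "topspace (prod_topology X Y) = (\<Union>n. topspace X \<times> C n)"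
      using C(3) by auto
    have "subtopology (prod_topology X Y) (topspace X \<times> C n) =
        prod_topology X (discrete_topology (C n))" for n
      by (simp add: C(2) subtopology_Times)
    then show "Delta_space (subtopology (prod_topology X Y) (topspace X \<times> C n))" for n
      by (simp add: Delta_space_prod_discrete assms(1))
  qed
qed

lemma countable_t1_imp_sigma_closed_discrete:
  assumes "t1_space Y" "countable (topspace Y)"
  shows "sigma_closed_discrete_space Y"
proof -
  \<comment> \<open>Intersecting with the space makes the surplus pieces empty when \<open>Y\<close> is empty, as the enumeration
    takes an arbitrary value then.\<close>
  define C where "C n = topspace Y \<inter> {from_nat_into (topspace Y) n}" for n
  have "closedin Y (C n)" for n
    using assms(1) unfolding C_def t1_space_closedin_finite by simp
  moreover have "subtopology Y (C n) = discrete_topology (C n)" for n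
    using assms(1) by (intro t1_space_subtopology finite_t1_space_imp_discrete_topology)
      (auto simp: C_def)
  moreover have "topspace Y = (\<Union>n. C n)"
  proof
    show "topspace Y \<subseteq> (\<Union>n. C n)"
      using from_nat_into_surj[OF assms(2)] unfolding C_def by fastforce
  qed (auto simp: C_def)
  ultimately show ?thesis
    unfolding sigma_closed_discrete_space_def by blast
qed

theorem corollary2p9:
  fixes X :: "'a topology" and Y :: "'b topology"
  assumes "tychonoff_space X" and "Delta_space X" and "tychonoff_space Y"
  shows "(sigma_closed_discrete_space Y \<longrightarrow> Delta_space (prod_topology X Y)) \<and>
         (countable (topspace Y) \<longrightarrow> sigma_closed_discrete_space Y)"
proof -
  have "t1_space Y"
    using assms(3) by (simp add: tychonoff_space_def Hausdorff_imp_t1_space)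
  then show ?thesis
    using Delta_space_prod_sigma_closed_discrete[OF assms(2)]
      countable_t1_imp_sigma_closed_discrete by blast
qed

end
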